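(* Let $\Theta$ be a finite set, $1\le T\le\infty$, $\mu\in\operatorname{int}\Delta(\Theta)$ a prior, and $\xi:\Theta\to\Delta(Z)$ a non-trivial static information structure with $Z$ finite. Let $H$ and $P$ be cdfs of random arrival times supported on $\{1,\dots,T\}$. Let $\pi_1$ (respectively $\pi_2$) be the dynamic information structure in which the realization of $\xi$ arrives at a random time with cdf $H$ (respectively $P$) and no other information arrives. Then $\pi_1$ dominates $\pi_2$ in the class of additively separable (AS) problems, i.e. $W(\pi_1)\ge W(\pi_2)$ for every AS problem with state space $\Theta$ and horizon $T$, if and only if $P$ first-order stochastically dominates $H$, i.e. $H(y)\ge P(y)$ for all $y\in\{1,\dots,T\}$.
   Context: Periods are $t\in\{1,\dots,T\}$ (all positive integers if $T=\infty$). $\Delta(X)$ denotes the probability measures on $X$. Let $\rho\in\Delta(\Delta(\Theta))$ be the (finitely supported) law of the posterior about $\theta$ after observing $z\sim\xi(\cdot\mid\theta)$ with $\theta\sim\mu$. Non-trivial means that $\rho$ is not the point mass $\delta_\mu$ at the prior. Random arrival: an arrival time $Y$ with values in $\{1,\dots,T\}$ and the given cdf is drawn independently of $(\theta,z)$. The agent observes $z$ in period $Y$ (before acting) and an uninformative null signal in every other period. The period-$t$ distribution over posteriors is the law of the belief about $\theta$ given everything observed in periods $1,\dots,t$; it is $F_t=H(t)\rho+(1-H(t))\delta_\mu$ under $\pi_1$ and $G_t=P(t)\rho+(1-P(t))\delta_\mu$ under $\pi_2$. AS problem: nonempty compact action sets $A_t$ and continuous $u_t:A_t\times\Theta\to\mathbb{R}$,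 one for each $t$, such that the total utility $u(a,\theta)=\sum_{t=1}^T u_t(a_t,\theta)$ is a finite (convergent) sum for all $a\in\prod_t A_t$, $\theta\in\Theta$. Value of a signal: put $V_t(x)=\max_{a_t\in A_t}\sum_{\theta}x(\theta)u_t(a_t,\theta)$ for $x\in\Delta(\Theta)$. The agent's optimal ex ante expected utility is $W(\pi_1)=\sum_{t=1}^T\mathbb{E}_{x\sim F_t}[V_t(x)]$ and $W(\pi_2)=\sum_{t=1}^T\mathbb{E}_{x\sim G_t}[V_t(x)]$. *)

theory Defs
  imports "HOL-Probability.Probability"
begin

definition periods :: "enat \<Rightarrow> nat set" where
  "periods T = {t. 1 \<le> t \<and> enat t \<le> T}"

(* Sums over the periods 1, ..., T in their natural order. For an infinite horizon the series
   need only converge conditionally; for a finite one it is a finite sum. The n-th term of the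
   series belongs to period Suc n. *)

definition horizon_term :: "enat \<Rightarrow> (nat \<Rightarrow> real) \<Rightarrow> nat \<Rightarrow> real" where
  "horizon_term T f n = (if Suc n \<in> periods T then f (Suc n) else 0)"

definition horizon_summable :: "enat \<Rightarrow> (nat \<Rightarrow> real) \<Rightarrow> bool" where
  "horizon_summable T f \<longleftrightarrow> summable (horizon_term T f)"

definition horizon_sum :: "enat \<Rightarrow> (nat \<Rightarrow> real) \<Rightarrow> real" where
  "horizon_sum T f = suminf (horizon_term T f)"

(* Delta(X) is rendered by the type of probability mass functions on X. All measures here are
   discrete: states and static signals are finite, and arrival times are countable. *)

definition joint_law :: "'a pmf \<Rightarrow> ('a \<Rightarrow> 's pmf) \<Rightarrow> ('a \<times> 's) pmf" where
  "joint_law \<mu> \<xi> = bind_pmf \<mu> (\<lambda>\<theta>. map_pmf (Pair \<theta>) (\<xi> \<theta>))"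

(* cond_pmf is meaningful only on events of positive probability, so this is the Bayesian
   posterior for s in the support of the signal. Only such s matter for belief_law. *)

definition posterior :: "('a \<times> 's) pmf \<Rightarrow> 's \<Rightarrow> 'a pmf" where
  "posterior J s = map_pmf fst (cond_pmf J {p. snd p = s})"

definition belief_law :: "'a pmf \<Rightarrow> ('a \<Rightarrow> 's pmf) \<Rightarrow> 'a pmf pmf" where
  "belief_law \<mu> \<xi> =
    map_pmf (posterior (joint_law \<mu> \<xi>)) (map_pmf snd (joint_law \<mu> \<xi>))"

definition nontrivial_info :: "'a pmf \<Rightarrow> ('a \<Rightarrow> 'z pmf) \<Rightarrow> bool" where
  "nontrivial_info \<mu> \<xi> \<longleftrightarrow> belief_law \<mu> \<xi> \<noteq> return_pmf \<mu>"

(* A dynamic information structure maps each state to a law of signal paths. The belief in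
   period t conditions on the signals of periods 1, ..., t. *)

definition history :: "nat \<Rightarrow> (nat \<Rightarrow> 's) \<Rightarrow> (nat \<Rightarrow> 's)" where
  "history t s = restrict s {1..t}"

definition period_belief_law ::
    "'a pmf \<Rightarrow> ('a \<Rightarrow> (nat \<Rightarrow> 's) pmf) \<Rightarrow> nat \<Rightarrow> 'a pmf pmf" where
  "period_belief_law \<mu> \<pi> t = belief_law \<mu> (\<lambda>\<theta>. map_pmf (history t) (\<pi> \<theta>))"

(* Y is the law of the arrival time, drawn independently of the state and of the realization z;
   None is the null signal. *)

definition arrival_structure ::
    "('a \<Rightarrow> 'z pmf) \<Rightarrow> nat pmf \<Rightarrow> 'a \<Rightarrow> (nat \<Rightarrow> 'z option) pmf" where
  "arrival_structure \<xi> Y \<theta> =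
    map_pmf (\<lambda>(z, y). \<lambda>t. if t = y then Some z else None) (pair_pmf (\<xi> \<theta>) Y)"

definition arrival_cdf :: "nat pmf \<Rightarrow> nat \<Rightarrow> real" where
  "arrival_cdf Y y = measure_pmf.prob Y {..y}"

(* The action space of each period is a topological space of its own, with points in 'b;
   A t and u t for t outside periods T are irrelevant. *)

definition AS_problem ::
    "enat \<Rightarrow> (nat \<Rightarrow> 'b topology) \<Rightarrow> (nat \<Rightarrow> 'b \<Rightarrow> 'a \<Rightarrow> real) \<Rightarrow> bool" where
  "AS_problem T A u \<longleftrightarrow>
    (\<forall>t\<in>periods T. topspace (A t) \<noteq> {} \<and> compact_space (A t) \<and>
       continuous_map (prod_topology (A t) (discrete_topology UNIV)) euclideanreal
         (\<lambda>(a, \<theta>). u t a \<theta>)) \<and>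
    (\<forall>a \<theta>. (\<forall>t\<in>periods T. a t \<in> topspace (A t)) \<longrightarrow>
       horizon_summable T (\<lambda>t. u t (a t) \<theta>))"

(* In an AS problem the supremum is a maximum, by compactness and continuity. *)

definition period_value :: "'b topology \<Rightarrow> ('b \<Rightarrow> 'a::finite \<Rightarrow> real) \<Rightarrow> 'a pmf \<Rightarrow> real" where
  "period_value A v x = (SUP a\<in>topspace A. \<Sum>\<theta>\<in>UNIV. pmf x \<theta> * v a \<theta>)"

(* For arrival structures of a finite static signal the series converges in every AS problem:
   the terms are V t \<mu> + H t * (E V t - V t \<mu>) with E the expectation under belief_law of the
   static signal, both V t \<mu> and E V t are summable by evaluating the total utility at
   maximizing action plans, the bracket is nonnegative, and H t lies between 0 and 1. *)

definition optimal_value ::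
    "enat \<Rightarrow> (nat \<Rightarrow> 'b topology) \<Rightarrow> (nat \<Rightarrow> 'b \<Rightarrow> 'a::finite \<Rightarrow> real) \<Rightarrow>
      'a pmf \<Rightarrow> ('a \<Rightarrow> (nat \<Rightarrow> 's) pmf) \<Rightarrow> real" where
  "optimal_value T A u \<mu> \<pi> =
    horizon_sum T (\<lambda>t. measure_pmf.expectation (period_belief_law \<mu> \<pi> t)
      (period_value (A t) (u t)))"

(* Dominance in the class of AS problems with actions drawn from the type 'b. HOL cannot
   quantify over types inside a formula, so the type is an explicit parameter. Problems transfer to larger
   types, and two elements suffice to tell information structures apart; over a one-element type
   no problem involves a choice and dominance is vacuous. *)

definition AS_dominates ::
    "'b itself \<Rightarrow> enat \<Rightarrow> 'a::finite pmf \<Rightarrow> ('a \<Rightarrow> (nat \<Rightarrow> 's) pmf) \<Rightarrow>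
      ('a \<Rightarrow> (nat \<Rightarrow> 's) pmf) \<Rightarrow> bool" where
  "AS_dominates (_ :: 'b itself) T \<mu> \<pi>1 \<pi>2 \<longleftrightarrow>
    (\<forall>(A :: nat \<Rightarrow> 'b topology) (u :: nat \<Rightarrow> 'b \<Rightarrow> 'a \<Rightarrow> real). AS_problem T A u \<longrightarrow>
       optimal_value T A u \<mu> \<pi>1 \<ge> optimal_value T A u \<mu> \<pi>2)"

(* FOSD T Q R: Q dominates R, so the cdf of Q is the smaller one. *)

definition FOSD :: "enat \<Rightarrow> nat pmf \<Rightarrow> nat pmf \<Rightarrow> bool" where
  "FOSD T Q R \<longleftrightarrow> (\<forall>y\<in>periods T. arrival_cdf R y \<ge> arrival_cdf Q y)"

end

theory Submission imports Defs begin

text \<open>With \<open>\<rho>\<close> the law of the static posterior and \<open>V t\<close> the value function of period \<open>t\<close>, the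
  expected value in period \<open>t\<close> is \<open>V t \<mu> + H t * D t\<close>, where \<open>D t\<close> is the gain of \<open>\<rho>\<close> over \<open>\<mu>\<close>.
  As \<open>\<rho>\<close> has mean \<open>\<mu>\<close> and \<open>V t\<close> is convex, \<open>D t \<ge> 0\<close>, so a larger cdf is better period by period.
  Conversely, a problem whose only choice is a bet in period \<open>y\<close> with \<open>D y > 0\<close> compares the two
  cdfs at \<open>y\<close>.\<close>

section \<open>Bayes' rule for a static signal\<close>

text \<open>Both total masses are 1, which forces \<open>c = 1\<close>. Posteriors can thus be
  identified from likelihoods up to a factor independent of the state, without evaluating
  normalizing constants.\<close>

lemma pmf_eqI_proportional:
  fixes p q :: "'a::finite pmf"
  assumes "\<And>x. pmf p x = c * pmf q x"
  shows "p = q"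
proof -
  have "(\<Sum>x\<in>UNIV. pmf p x) = c * (\<Sum>x\<in>UNIV. pmf q x)"
    by (simp add: assms sum_distrib_left)
  then have "c = 1"
    by (simp add: sum_pmf_eq_1)
  then show ?thesis
    by (simp add: assms pmf_eqI)
qed

lemma pmf_joint_law:
  fixes \<mu> :: "'a::finite pmf"
  shows "pmf (joint_law \<mu> \<xi>) (\<theta>, s) = pmf \<mu> \<theta> * pmf (\<xi> \<theta>) s"
proof -
  have *: "pmf (map_pmf (Pair \<theta>') (\<xi> \<theta>')) (\<theta>, s) = (if \<theta>' = \<theta> then pmf (\<xi> \<theta>) s else 0)" for \<theta>'
    using pmf_map_inj'[of "Pair \<theta>'" "\<xi> \<theta>'" s]
    by (auto simp: inj_on_def intro!: pmf_map_outside)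
  show ?thesis
    unfolding joint_law_def pmf_bind *
    by (subst integral_measure_pmf[where A = UNIV]) (auto simp: if_distrib cong: if_cong)
qed

lemma map_snd_joint_law: "map_pmf snd (joint_law \<mu> \<xi>) = bind_pmf \<mu> \<xi>"
  by (simp add: joint_law_def map_bind_pmf pmf.map_comp o_def)

text \<open>Bayes' rule. The hypothesis gives the conditioning event positive probability, as
  \<open>cond_pmf\<close> requires.\<close>

lemma pmf_posterior:
  assumes "s \<in> set_pmf (map_pmf snd J)"
  shows "pmf (posterior J s) \<theta> = pmf J (\<theta>, s) / pmf (map_pmf snd J) s"
proof -
  let ?C = "cond_pmf J {p. snd p = s}"
  have ne: "set_pmf J \<inter> {p. snd p = s} \<noteq> {}"
    using assms by auto
  have "pmf (posterior J s) \<theta> = measure_pmf.prob ?C (fst -` {\<theta>})"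
    by (simp add: posterior_def pmf_map)
  also have "\<dots> = measure_pmf.prob ?C {(\<theta>, s)}"
    by (rule measure_prob_cong_0) (auto simp: pmf_cond[OF ne])
  also have "\<dots> = pmf J (\<theta>, s) / measure_pmf.prob J {p. snd p = s}"
    by (simp add: measure_pmf_single pmf_cond[OF ne])
  also have "{p. snd p = s} = snd -` {s}"
    by auto
  finally show ?thesis
    by (simp add: pmf_map)
qed

lemma expectation_belief_law:
  fixes \<mu> :: "'a::finite pmf" and \<xi> :: "'a \<Rightarrow> 'z::finite pmf"
  shows "measure_pmf.expectation (belief_law \<mu> \<xi>) f =
    (\<Sum>z\<in>UNIV. pmf (bind_pmf \<mu> \<xi>) z * f (posterior (joint_law \<mu> \<xi>) z))"
  unfolding belief_law_def map_snd_joint_law integral_map_pmf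
  by (subst integral_measure_pmf[where A = UNIV]) auto

text \<open>Posteriors average to the prior: each summand is the joint mass of \<theta> and
  \<open>z\<close>, by Bayes' rule if \<open>z\<close> has positive probability and because both
  sides vanish otherwise. Summing over \<open>z\<close> leaves the prior mass.\<close>

lemma bayes_plausibility:
  fixes \<mu> :: "'a::finite pmf" and \<xi> :: "'a \<Rightarrow> 'z::finite pmf"
  shows "(\<Sum>z\<in>UNIV. pmf (bind_pmf \<mu> \<xi>) z * pmf (posterior (joint_law \<mu> \<xi>) z) \<theta>) = pmf \<mu> \<theta>"
proof -
  have "pmf (bind_pmf \<mu> \<xi>) z * pmf (posterior (joint_law \<mu> \<xi>) z) \<theta> = pmf \<mu> \<theta> * pmf (\<xi> \<theta>) z" for z
  proof (cases "z \<in> set_pmf (map_pmf snd (joint_law \<mu> \<xi>))")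
    case True
    then have "pmf (bind_pmf \<mu> \<xi>) z \<noteq> 0"
      unfolding map_snd_joint_law set_pmf_iff .
    then show ?thesis
      by (simp add: pmf_posterior[OF True] map_snd_joint_law pmf_joint_law)
  next
    case False
    then have "(\<theta>, z) \<notin> set_pmf (joint_law \<mu> \<xi>)"
      by force
    then have "pmf \<mu> \<theta> * pmf (\<xi> \<theta>) z = 0"
      using pmf_joint_law[of \<mu> \<xi> \<theta> z] by (simp add: set_pmf_iff)
    moreover from False have "pmf (bind_pmf \<mu> \<xi>) z = 0"
      unfolding map_snd_joint_law set_pmf_iff by simp
    ultimately show ?thesis
      by simp
  qed
  then show ?thesis
    by (simp add: sum_distrib_left[symmetric] sum_pmf_eq_1)
qed

section \<open>Beliefs under a random arrival time\<close>

text \<open>What is observed up to \<open>t\<close>, as a function of the underlying draw: the law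
  of histories becomes the image of a product measure.\<close>

definition arrival_history :: "nat \<Rightarrow> 'z \<times> nat \<Rightarrow> nat \<Rightarrow> 'z option" where
  "arrival_history t = (\<lambda>(z, y). history t (\<lambda>s. if s = y then Some z else None))"

text \<open>Once the signal has arrived, entry \<open>y\<close> of the history reveals both its
  content and its date. The bound \<open>1 \<le> y\<close> matters because histories start in period
  1.\<close>

lemma arrival_history_eq_iff:
  assumes "1 \<le> y" "y \<le> t"
  shows "arrival_history t (z', y') = arrival_history t (z, y) \<longleftrightarrow> z' = z \<and> y' = y"
proof
  assume "arrival_history t (z', y') = arrival_history t (z, y)"
  then have "arrival_history t (z', y') y = arrival_history t (z, y) y"
    by simp
  then show "z' = z \<and> y' = y"
    using assms by (auto simp: arrival_history_def history_def split: if_splits)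
qed simp

lemma arrival_history_late:
  "t < y \<Longrightarrow> arrival_history t (z, y) = history t (\<lambda>_. None)"
  by (auto simp: arrival_history_def history_def fun_eq_iff restrict_def)

text \<open>After arrival the history amounts to \<open>(z, y)\<close>, and the date is independent
  of the state, so the posterior is the static one. Before arrival the null history has the same
  likelihood in every state, so the prior persists. An arrival at 0 would never be observed, hence
  the hypothesis.\<close>

lemma period_belief_law_arrival:
  fixes \<mu> :: "'a::finite pmf" and \<xi> :: "'a \<Rightarrow> 'z pmf"
  assumes "0 \<notin> set_pmf Y"
  shows "period_belief_law \<mu> (arrival_structure \<xi> Y) t =
    bind_pmf Y (\<lambda>y. if y \<le> t then belief_law \<mu> \<xi> else return_pmf \<mu>)"
proof -
  let ?g = "arrival_history t"
  let ?\<xi>' = "\<lambda>\<theta>. map_pmf ?g (pair_pmf (\<xi> \<theta>) Y)"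
  let ?J = "joint_law \<mu> \<xi>" and ?J' = "joint_law \<mu> ?\<xi>'"
  have \<xi>': "map_pmf (history t) (arrival_structure \<xi> Y \<theta>) = ?\<xi>' \<theta>" for \<theta>
    by (simp add: arrival_structure_def pmf.map_comp o_def arrival_history_def case_prod_beta')
  have marg: "map_pmf snd ?J' = map_pmf ?g (pair_pmf (map_pmf snd ?J) Y)"
    by (simp add: map_snd_joint_law map_bind_pmf[symmetric] pair_pmf_def bind_assoc_pmf)
  have post: "posterior ?J' (?g (z, y)) = (if y \<le> t then posterior ?J z else \<mu>)"
    if z: "z \<in> set_pmf (map_pmf snd ?J)" and y: "y \<in> set_pmf Y" for z y
  proof -
    have "?g (z, y) \<in> set_pmf (map_pmf snd ?J')"
      unfolding marg using z y by auto
    note post' = pmf_posterior[OF this]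
    have "1 \<le> y"
      using y assms by (cases y) auto
    show ?thesis
    proof (cases "y \<le> t")
      case True
      have "pmf (?\<xi>' \<theta>) (?g (z, y)) = pmf (\<xi> \<theta>) z * pmf Y y" for \<theta>
      proof -
        have "?g -` {?g (z, y)} = {(z, y)}"
          by (auto simp: arrival_history_eq_iff[OF \<open>1 \<le> y\<close> True])
        then show ?thesis
          by (simp add: pmf_map measure_pmf_single pmf_pair)
      qed
      moreover have "pmf (map_pmf snd ?J) z \<noteq> 0"
        using z unfolding set_pmf_iff .
      \<comment> \<open>The factor \<open>c\<close> combines the probability of the date with the
        ratio of the two normalizing constants; none of these depends on \<theta>.\<close>
      ultimately have "posterior ?J' (?g (z, y)) = posterior ?J z"
        by (intro pmf_eqI_proportional[where
            c = "pmf Y y * pmf (map_pmf snd ?J) z / pmf (map_pmf snd ?J') (?g (z, y))"])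
          (simp add: post' pmf_posterior[OF z] pmf_joint_law)
      with True show ?thesis
        by simp
    next
      case False
      then have late: "?g (z, y) = history t (\<lambda>_. None)"
        by (simp add: arrival_history_late)
      have "pmf (?\<xi>' \<theta>) (?g (z, y)) = measure_pmf.prob Y {t<..}" for \<theta>
      proof -
        \<comment> \<open>The equivalence fails at \<open>y' = 0\<close>, so the two events are
          matched only up to a null set.\<close>
        have "?g (z', y') = history t (\<lambda>_. None) \<longleftrightarrow> t < y'" if "y' \<in> set_pmf Y" for z' :: 'z and y'
        proof
          assume *: "?g (z', y') = history t (\<lambda>_. None)"
          show "t < y'"
          proof (rule ccontr)
            assume "\<not> t < y'"
            moreover have "1 \<le> y'"
              using that assms by (cases y') auto
            ultimately show False
              using arrival_history_eq_iff[of y' t z y z'] late * False by auto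
          qed
        qed (simp add: arrival_history_late)
        then have "pmf (?\<xi>' \<theta>) (?g (z, y)) =
            measure_pmf.prob (pair_pmf (\<xi> \<theta>) Y) (snd -` {t<..})"
          unfolding pmf_map late
          by (intro measure_prob_cong_0) (auto simp: pmf_pair set_pmf_iff)
        also have "\<dots> = measure_pmf.prob (map_pmf snd (pair_pmf (\<xi> \<theta>) Y)) {t<..}"
          by simp
        finally show ?thesis
          by (simp only: map_snd_pair_pmf)
      qed
      then have "posterior ?J' (?g (z, y)) = \<mu>"
        by (intro pmf_eqI_proportional[where
            c = "measure_pmf.prob Y {t<..} / pmf (map_pmf snd ?J') (?g (z, y))"])
          (simp add: post' pmf_joint_law)
      with False show ?thesis
        by simp
    qed
  qed
  have "period_belief_law \<mu> (arrival_structure \<xi> Y) t =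
      map_pmf (\<lambda>p. posterior ?J' (?g p)) (pair_pmf (map_pmf snd ?J) Y)"
    unfolding period_belief_law_def \<xi>' belief_law_def marg by (simp add: pmf.map_comp o_def)
  also have "\<dots> = map_pmf (\<lambda>(z, y). if y \<le> t then posterior ?J z else \<mu>) (pair_pmf (map_pmf snd ?J) Y)"
    by (rule map_pmf_cong) (use post in auto)
  \<comment> \<open>By independence the arrival time may be drawn first.\<close>
  also have "\<dots> = bind_pmf Y (\<lambda>y. map_pmf (\<lambda>z. if y \<le> t then posterior ?J z else \<mu>) (map_pmf snd ?J))"
    unfolding pair_pmf_def map_bind_pmf
    by (subst bind_commute_pmf) (simp add: map_pmf_def bind_assoc_pmf bind_return_pmf)
  also have "\<dots> = bind_pmf Y (\<lambda>y. if y \<le> t then belief_law \<mu> \<xi> else return_pmf \<mu>)"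
    by (intro bind_pmf_cong) (auto simp: belief_law_def map_pmf_const)
  finally show ?thesis .
qed

lemma expectation_period_belief_law_arrival:
  fixes \<mu> :: "'a::finite pmf" and \<xi> :: "'a \<Rightarrow> 'z::finite pmf"
  assumes "0 \<notin> set_pmf Y"
  shows "measure_pmf.expectation (period_belief_law \<mu> (arrival_structure \<xi> Y) t) f =
    f \<mu> + arrival_cdf Y t * (measure_pmf.expectation (belief_law \<mu> \<xi>) f - f \<mu>)"
proof -
  \<comment> \<open>Only whether the signal has arrived matters. Collapsing \<open>Y\<close> to a
    Boolean turns a possibly infinite mixture into two terms, with no integrability condition on
    \<open>f\<close>.\<close>
  let ?B = "map_pmf (\<lambda>y. y \<le> t) Y"
  have "pmf ?B True = arrival_cdf Y t"
    by (simp add: pmf_map arrival_cdf_def vimage_def atMost_def)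
  moreover have "pmf ?B True + pmf ?B False = 1"
    using sum_pmf_eq_1[of UNIV ?B, OF finite subset_UNIV] by (simp add: UNIV_bool add.commute)
  ultimately have B: "pmf ?B True = arrival_cdf Y t" "pmf ?B False = 1 - arrival_cdf Y t"
    by auto
  have "period_belief_law \<mu> (arrival_structure \<xi> Y) t =
      bind_pmf ?B (\<lambda>b. if b then belief_law \<mu> \<xi> else return_pmf \<mu>)"
    by (simp add: period_belief_law_arrival[OF assms] bind_map_pmf)
  moreover have "measure_pmf.expectation (bind_pmf ?B (\<lambda>b. if b then belief_law \<mu> \<xi> else return_pmf \<mu>)) f =
      (\<Sum>b\<in>UNIV. pmf ?B b *\<^sub>R
        measure_pmf.expectation (if b then belief_law \<mu> \<xi> else return_pmf \<mu>) f)"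
    by (rule pmf_expectation_bind) (auto simp: belief_law_def)
  ultimately show ?thesis
    by (simp add: UNIV_bool B algebra_simps)
qed

section \<open>Period values and sums over the horizon\<close>

lemma compact_space_attains_sup:
  assumes "compact_space X" "topspace X \<noteq> {}" "continuous_map X euclideanreal f"
  obtains a where "a \<in> topspace X" "\<And>b. b \<in> topspace X \<Longrightarrow> f b \<le> f a"
proof -
  have "compact (f ` topspace X)"
    using image_compactin[of X "topspace X" euclideanreal f] assms
    by (simp add: compact_space_def)
  with assms(2) obtain m where "m \<in> f ` topspace X" "\<forall>x\<in>f ` topspace X. x \<le> m"
    using compact_attains_sup[of "f ` topspace X"] by auto
  then show thesis
    using that by auto
qed

lemma period_value_attained:
  fixes x :: "'a::finite pmf"
  assumes "AS_problem T A u" "t \<in> periods T"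
  obtains a where "a \<in> topspace (A t)"
    "period_value (A t) (u t) x = (\<Sum>\<theta>\<in>UNIV. pmf x \<theta> * u t a \<theta>)"
    "\<And>b. b \<in> topspace (A t) \<Longrightarrow> (\<Sum>\<theta>\<in>UNIV. pmf x \<theta> * u t b \<theta>) \<le> period_value (A t) (u t) x"
proof -
  have A: "topspace (A t) \<noteq> {}" "compact_space (A t)"
    and u: "continuous_map (prod_topology (A t) (discrete_topology UNIV)) euclideanreal (\<lambda>(a, \<theta>). u t a \<theta>)"
    using assms by (auto simp: AS_problem_def)
  let ?f = "\<lambda>a. \<Sum>\<theta>\<in>UNIV. pmf x \<theta> * u t a \<theta>"
  have "continuous_map (A t) euclideanreal (\<lambda>a. u t a \<theta>)" for \<theta>
  proof -
    have "continuous_map (A t) (prod_topology (A t) (discrete_topology UNIV)) (\<lambda>a. (a, \<theta>))"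
      by (simp add: continuous_map_pairedI)
    from continuous_map_compose[OF this u] show ?thesis
      by (simp add: o_def)
  qed
  then have "continuous_map (A t) euclideanreal ?f"
    by (intro continuous_map_sum continuous_map_real_mult) auto
  with A obtain a where a: "a \<in> topspace (A t)" "\<And>b. b \<in> topspace (A t) \<Longrightarrow> ?f b \<le> ?f a"
    using compact_space_attains_sup by blast
  then have "period_value (A t) (u t) x = ?f a"
    unfolding period_value_def by (intro cSup_eq_maximum) auto
  with a that show thesis
    by metis
qed

lemma horizon_summable_add:
  assumes "horizon_summable T f" "horizon_summable T g"
  shows "horizon_summable T (\<lambda>t. f t + g t)"
proof -
  have "horizon_term T (\<lambda>t. f t + g t) = (\<lambda>n. horizon_term T f n + horizon_term T g n)"
    by (auto simp: horizon_term_def)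
  with assms show ?thesis
    by (simp add: horizon_summable_def summable_add)
qed

lemma horizon_summable_diff:
  assumes "horizon_summable T f" "horizon_summable T g"
  shows "horizon_summable T (\<lambda>t. f t - g t)"
proof -
  have "horizon_term T (\<lambda>t. f t - g t) = (\<lambda>n. horizon_term T f n - horizon_term T g n)"
    by (auto simp: horizon_term_def)
  with assms show ?thesis
    by (simp add: horizon_summable_def summable_diff)
qed

lemma horizon_summable_weighted_sum:
  assumes "\<And>i. i \<in> I \<Longrightarrow> horizon_summable T (f i)"
  shows "horizon_summable T (\<lambda>t. \<Sum>i\<in>I. c i * f i t)"
proof -
  have "horizon_term T (\<lambda>t. \<Sum>i\<in>I. c i * f i t) = (\<lambda>n. \<Sum>i\<in>I. c i * horizon_term T (f i) n)"
    by (auto simp: horizon_term_def)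
  with assms show ?thesis
    by (simp add: horizon_summable_def summable_sum summable_mult)
qed

lemma horizon_summable_cong:
  "(\<And>t. t \<in> periods T \<Longrightarrow> f t = g t) \<Longrightarrow> horizon_summable T f \<longleftrightarrow> horizon_summable T g"
  unfolding horizon_summable_def
  by (rule arg_cong[where f = summable]) (auto simp: horizon_term_def)

lemma horizon_sum_mono:
  assumes "\<And>t. t \<in> periods T \<Longrightarrow> f t \<le> g t" "horizon_summable T f" "horizon_summable T g"
  shows "horizon_sum T f \<le> horizon_sum T g"
  unfolding horizon_sum_def
  by (rule suminf_le) (use assms in \<open>auto simp: horizon_term_def horizon_summable_def\<close>)

lemma horizon_sum_single:
  assumes "y \<in> periods T" "\<And>t. t \<noteq> y \<Longrightarrow> f t = 0"
  shows "horizon_sum T f = f y"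
proof -
  have "y \<noteq> 0"
    using assms(1) by (auto simp: periods_def)
  then obtain k where k: "y = Suc k"
    using not0_implies_Suc by blast
  have "horizon_sum T f = (\<Sum>n\<in>{k}. horizon_term T f n)"
    unfolding horizon_sum_def by (rule suminf_finite) (auto simp: horizon_term_def assms(2) k)
  then show ?thesis
    using assms(1) by (simp add: horizon_term_def k)
qed

text \<open>Maximizers at \<open>x\<close>, one per period, form a single action plan. Its utility
  converges in every state by the definition of an AS problem, hence so does the finite average over
  states.\<close>

lemma horizon_summable_period_value:
  assumes "AS_problem T A u"
  shows "horizon_summable T (\<lambda>t. period_value (A t) (u t) x)"
proof -
  have "\<exists>a. t \<in> periods T \<longrightarrow> a \<in> topspace (A t) \<and>
      period_value (A t) (u t) x = (\<Sum>\<theta>\<in>UNIV. pmf x \<theta> * u t a \<theta>)" for t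
    using period_value_attained[OF assms, of t] by metis
  then obtain a where a: "\<And>t. t \<in> periods T \<Longrightarrow> a t \<in> topspace (A t) \<and>
      period_value (A t) (u t) x = (\<Sum>\<theta>\<in>UNIV. pmf x \<theta> * u t (a t) \<theta>)"
    by metis
  have "horizon_summable T (\<lambda>t. u t (a t) \<theta>)" for \<theta>
    using assms a by (simp add: AS_problem_def)
  then have "horizon_summable T (\<lambda>t. \<Sum>\<theta>\<in>UNIV. pmf x \<theta> * u t (a t) \<theta>)"
    by (intro horizon_summable_weighted_sum)
  then show ?thesis
    by (subst horizon_summable_cong) (use a in auto)
qed

section \<open>Comparison of arrival times\<close>

text \<open>An action optimal at the prior stays feasible at every posterior. Its payoff is linear
  in the belief, so by Bayes plausibility it averages to the prior value.\<close>

lemma period_value_le_expectation: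
  fixes \<mu> :: "'a::finite pmf" and \<xi> :: "'a \<Rightarrow> 'z::finite pmf"
  assumes "AS_problem T A u" "t \<in> periods T"
  shows "period_value (A t) (u t) \<mu> \<le>
    measure_pmf.expectation (belief_law \<mu> \<xi>) (period_value (A t) (u t))"
proof -
  let ?m = "pmf (bind_pmf \<mu> \<xi>)" and ?x = "posterior (joint_law \<mu> \<xi>)"
  obtain a where a: "a \<in> topspace (A t)"
    "period_value (A t) (u t) \<mu> = (\<Sum>\<theta>\<in>UNIV. pmf \<mu> \<theta> * u t a \<theta>)"
    using period_value_attained[OF assms] by metis
  have le: "(\<Sum>\<theta>\<in>UNIV. pmf x \<theta> * u t a \<theta>) \<le> period_value (A t) (u t) x" for x
    using period_value_attained[OF assms] a(1) by metis
  have "(\<Sum>\<theta>\<in>UNIV. pmf \<mu> \<theta> * u t a \<theta>) =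
      (\<Sum>\<theta>\<in>UNIV. (\<Sum>z\<in>UNIV. ?m z * pmf (?x z) \<theta>) * u t a \<theta>)"
    by (simp only: bayes_plausibility)
  also have "\<dots> = (\<Sum>z\<in>UNIV. ?m z * (\<Sum>\<theta>\<in>UNIV. pmf (?x z) \<theta> * u t a \<theta>))"
    unfolding sum_distrib_left sum_distrib_right by (subst sum.swap) (simp add: mult.assoc)
  also have "\<dots> \<le> (\<Sum>z\<in>UNIV. ?m z * period_value (A t) (u t) (?x z))"
    by (intro sum_mono mult_left_mono le) simp
  finally show ?thesis
    by (simp add: a(2) expectation_belief_law)
qed

lemma nontrivial_info_obtain_posterior:
  fixes \<mu> :: "'a::finite pmf"
  assumes "nontrivial_info \<mu> \<xi>"
  obtains z where "z \<in> set_pmf (bind_pmf \<mu> \<xi>)" "posterior (joint_law \<mu> \<xi>) z \<noteq> \<mu>"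
proof -
  have "\<not> set_pmf (belief_law \<mu> \<xi>) \<subseteq> {\<mu>}"
    using assms by (simp add: nontrivial_info_def set_pmf_subset_singleton)
  then show thesis
    using that unfolding belief_law_def map_snd_joint_law by auto
qed

lemma optimal_value_arrival_mono:
  fixes \<mu> :: "'a::finite pmf" and \<xi> :: "'a \<Rightarrow> 'z::finite pmf"
  assumes AS: "AS_problem T A u"
    and Y: "0 \<notin> set_pmf Y" "0 \<notin> set_pmf Y'"
    and le: "\<And>t. t \<in> periods T \<Longrightarrow> arrival_cdf Y t \<le> arrival_cdf Y' t"
  shows "optimal_value T A u \<mu> (arrival_structure \<xi> Y) \<le> optimal_value T A u \<mu> (arrival_structure \<xi> Y')"
proof -
  let ?V = "\<lambda>t. period_value (A t) (u t)"
  let ?D = "\<lambda>t. measure_pmf.expectation (belief_law \<mu> \<xi>) (?V t) - ?V t \<mu>"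
  have D: "horizon_summable T ?D"
    unfolding expectation_belief_law
    by (intro horizon_summable_diff horizon_summable_weighted_sum horizon_summable_period_value AS)
  have nonneg: "0 \<le> ?D t" if "t \<in> periods T" for t
    using period_value_le_expectation[OF AS that] by simp
  \<comment> \<open>The values may converge only conditionally, and weights in [0, 1] could then
    destroy convergence. The gains \<open>?D\<close> are nonnegative, so comparison with their own
    series applies.\<close>
  have sm: "horizon_summable T (\<lambda>t. ?V t \<mu> + arrival_cdf Z t * ?D t)" for Z
  proof (rule horizon_summable_add[OF horizon_summable_period_value[OF AS]])
    show "horizon_summable T (\<lambda>t. arrival_cdf Z t * ?D t)"
      unfolding horizon_summable_def
    proof (rule summable_comparison_test')
      show "summable (horizon_term T ?D)"
        using D by (simp add: horizon_summable_def)
      show "norm (horizon_term T (\<lambda>t. arrival_cdf Z t * ?D t) n) \<le> horizon_term T ?D n" if "n \<ge> 0" for n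
        using nonneg[of "Suc n"]
        by (auto simp: horizon_term_def abs_mult arrival_cdf_def intro!: mult_left_le_one_le)
    qed
  qed
  show ?thesis
    unfolding optimal_value_def
    by (simp only: expectation_period_belief_law_arrival Y not_False_eq_True)
      (intro horizon_sum_mono sm add_left_mono mult_right_mono le nonneg)
qed

text \<open>A single risky bet in period \<open>y\<close>, along the displacement of one posterior from the prior and
  recentred so that the prior is indifferent: it is worthless without information and strictly
  valuable with it.\<close>

lemma ex_informative_bet:
  fixes \<mu> :: "'a::finite pmf" and \<xi> :: "'a \<Rightarrow> 'z::finite pmf" and a b :: 'b
  assumes "nontrivial_info \<mu> \<xi>" "a \<noteq> b"
  obtains A :: "nat \<Rightarrow> 'b topology" and u where "AS_problem T A u"
    "period_value (A y) (u y) \<mu> = 0"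
    "0 < measure_pmf.expectation (belief_law \<mu> \<xi>) (period_value (A y) (u y))"
    "\<And>t. t \<noteq> y \<Longrightarrow> period_value (A t) (u t) = (\<lambda>_. 0)"
proof -
  let ?m = "pmf (bind_pmf \<mu> \<xi>)" and ?x = "posterior (joint_law \<mu> \<xi>)"
  obtain z where z: "z \<in> set_pmf (bind_pmf \<mu> \<xi>)" "?x z \<noteq> \<mu>"
    using nontrivial_info_obtain_posterior[OF assms(1)] .
  define d where "d = (\<lambda>\<theta>. pmf (?x z) \<theta> - pmf \<mu> \<theta>)"
  define w where "w = (\<lambda>\<theta>. d \<theta> - (\<Sum>\<theta>'\<in>UNIV. pmf \<mu> \<theta>' * d \<theta>'))"
  \<comment> \<open>The bet pays the inner product of \<open>x - \<mu>\<close> with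
    \<open>d\<close>: zero at the prior, and the squared length of \<open>d\<close> at
    \<open>?x z\<close>.\<close>
  have w: "(\<Sum>\<theta>\<in>UNIV. pmf x \<theta> * w \<theta>) = (\<Sum>\<theta>\<in>UNIV. (pmf x \<theta> - pmf \<mu> \<theta>) * d \<theta>)" for x
    by (simp add: w_def right_diff_distrib left_diff_distrib sum_subtractf
        sum_distrib_right[symmetric] sum_pmf_eq_1)
  obtain \<theta>0 where "d \<theta>0 \<noteq> 0"
    using z(2) by (auto simp: d_def intro: pmf_eqI)
  then have d_pos: "0 < (\<Sum>\<theta>\<in>UNIV. d \<theta> * d \<theta>)"
    by (intro sum_pos2[where i = \<theta>0]) (auto simp: zero_less_mult_iff)
  define A where "A = (\<lambda>t::nat. discrete_topology {a, b})"
  define u where "u = (\<lambda>t c \<theta>. if t = y \<and> c = a then w \<theta> else 0)"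
  have AS: "AS_problem T A u"
  proof -
    have "summable (horizon_term T (\<lambda>t. u t (c t) \<theta>))" for c \<theta>
    proof (rule summable_finite)
      show "finite {n. Suc n = y}"
        by (rule finite_subset[of _ "{..y}"]) auto
    qed (auto simp: horizon_term_def u_def)
    then show ?thesis
      by (simp add: AS_problem_def A_def compact_space_discrete_topology horizon_summable_def
          flip: prod_topology_discrete_topology)
  qed
  \<comment> \<open>Action \<open>a\<close> takes the bet and \<open>b\<close> declines it. The
    option to decline makes every realization contribute nonnegatively to the expectation
    below.\<close>
  have V: "period_value (A y) (u y) x = max 0 (\<Sum>\<theta>\<in>UNIV. pmf x \<theta> * w \<theta>)" for x
    using assms(2) by (simp add: period_value_def A_def u_def cSup_eq_Max max.commute)
  show thesis
  proof (rule that[OF AS])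
    show "period_value (A y) (u y) \<mu> = 0"
      unfolding V w by simp
    have "0 < ?m z * period_value (A y) (u y) (?x z)"
      unfolding V w using d_pos pmf_positive[OF z(1)] by (simp add: d_def)
    then show "0 < measure_pmf.expectation (belief_law \<mu> \<xi>) (period_value (A y) (u y))"
      unfolding expectation_belief_law
      by (intro sum_pos2[where i = z]) (auto simp: V)
    show "period_value (A t) (u t) = (\<lambda>_. 0)" if "t \<noteq> y" for t
      using that by (simp add: fun_eq_iff period_value_def A_def u_def)
  qed
qed

theorem corollary4p3:
  fixes T :: enat
    and \<mu> :: "'a::finite pmf"
    and \<xi> :: "'a \<Rightarrow> 'z::finite pmf"
    and Y\<^sub>H Y\<^sub>P :: "nat pmf"
  assumes horizon: "1 \<le> T"
    and interior: "\<forall>\<theta>. pmf \<mu> \<theta> > 0"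
    and nontrivial: "nontrivial_info \<mu> \<xi>"
    and support_H: "set_pmf Y\<^sub>H \<subseteq> periods T"
    and support_P: "set_pmf Y\<^sub>P \<subseteq> periods T"
    and actions: "\<exists>a b :: 'b. a \<noteq> b"
  shows "AS_dominates TYPE('b) T \<mu> (arrival_structure \<xi> Y\<^sub>H) (arrival_structure \<xi> Y\<^sub>P)
    \<longleftrightarrow> FOSD T Y\<^sub>P Y\<^sub>H"
proof -
  have H: "0 \<notin> set_pmf Y\<^sub>H" and P: "0 \<notin> set_pmf Y\<^sub>P"
    using support_H support_P by (auto simp: periods_def)
  show ?thesis
  proof
    assume "FOSD T Y\<^sub>P Y\<^sub>H"
    then show "AS_dominates TYPE('b) T \<mu> (arrival_structure \<xi> Y\<^sub>H) (arrival_structure \<xi> Y\<^sub>P)"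
      unfolding AS_dominates_def FOSD_def using optimal_value_arrival_mono[OF _ P H] by blast
  next
    assume dom: "AS_dominates TYPE('b) T \<mu> (arrival_structure \<xi> Y\<^sub>H) (arrival_structure \<xi> Y\<^sub>P)"
    show "FOSD T Y\<^sub>P Y\<^sub>H"
      unfolding FOSD_def
    proof
      fix y assume y: "y \<in> periods T"
      from actions obtain a b :: 'b where "a \<noteq> b"
        by blast
      from ex_informative_bet[OF nontrivial this, of T y] obtain A :: "nat \<Rightarrow> 'b topology" and u
        where AS: "AS_problem T A u"
          and V: "period_value (A y) (u y) \<mu> = 0"
            "0 < measure_pmf.expectation (belief_law \<mu> \<xi>) (period_value (A y) (u y))" (is "0 < ?E")
            "\<And>t. t \<noteq> y \<Longrightarrow> period_value (A t) (u t) = (\<lambda>_. 0)"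
        by metis
      \<comment> \<open>Only period \<open>y\<close> contributes, and its prior value is zero, so
        the total is the cdf at \<open>y\<close> times a positive constant common to both
        structures.\<close>
      have "optimal_value T A u \<mu> (arrival_structure \<xi> Y) = arrival_cdf Y y * ?E"
        if "0 \<notin> set_pmf Y" for Y
        unfolding optimal_value_def
        by (subst horizon_sum_single[OF y])
          (simp_all add: expectation_period_belief_law_arrival[OF that] V)
      with dom AS H P have "arrival_cdf Y\<^sub>P y * ?E \<le> arrival_cdf Y\<^sub>H y * ?E"
        unfolding AS_dominates_def by metis
      with V(2) show "arrival_cdf Y\<^sub>P y \<le> arrival_cdf Y\<^sub>H y"
        by simp
    qed
  qed
qed

end
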